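(* Let $P_{k,\ell}(G)$ denote the convex hull in $\mathbb{R}^E$ of the incidence vectors of all edge subsets $F\subseteq E$ such that $(V,F)$ is $(k,\ell)$-tight. For all integers $k,\ell$ with $k\ge 1$ and $0 \leq \ell \leq k$ and every finite simple undirected graph $G=(V,E)$, the polytope $P_{k,\ell}(G)$ has an extended formulation of size $O(|V||E|)$. That is, there is an absolute constant $C$ (independent of $k,\ell,G$) such that for all such $k,\ell,G$ the polytope $P_{k,\ell}(G)$ has an extended formulation of size at most $C|V||E|$.
   Context: Let $k,\ell$ be integers with $0\le \ell\le 2k-1$. A finite simple undirected graph $H=(V,F)$ is $(k,\ell)$-sparse if $|F'| \leq \max\{k|V(F')|-\ell,\,0\}$ for every $F'\subseteq F$, where $V(F')$ is the set of vertices incident to at least one edge of $F'$. It is $(k,\ell)$-tight if it is $(k,\ell)$-sparse and $|F|=\max\{k|V|-\ell,\,0\}$. For a finite simple undirected graph $G=(V,E)$, let $\mathcal{F}_{k,\ell}(G)\subseteq 2^E$ be the family of all $F\subseteq E$ such that the graph $(V,F)$ (on the full vertex set $V$) is $(k,\ell)$-tight, and let $$P_{k,\ell}(G)=\mathrm{conv}\{\chi_F\in\mathbb{R}^E \mid F\in\mathcal{F}_{k,\ell}(G)\},$$ where $\chi_F$ is the incidence vector of $F$. An extended formulation of a polytope $P\subseteq\mathbb{R}^d$ is a polytope $Q\subseteq\mathbb{R}^p$, $p\ge d$, such that there is a linear projection $\pi\colon\mathbb{R}^p\to\mathbb{R}^d$ with $\pi(Q)=P$. Its size is the number of facets of $Q$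 (facets are understood as nonempty faces of dimension $\dim Q-1$). *)

theory Defs
  imports "HOL-Analysis.Analysis" "HOL-Analysis.Finite_Function_Topology"
begin

definition simple_graph :: "'v set \<Rightarrow> 'v set set \<Rightarrow> bool" where
  "simple_graph V E \<longleftrightarrow> finite V \<and> (\<forall>e\<in>E. e \<subseteq> V \<and> card e = 2)"

text \<open>Since edges are two-element vertex sets, the set of vertices incident to
  an edge of \<open>F'\<close> is \<open>\<Union>F'\<close>.\<close>

definition sparse :: "int \<Rightarrow> int \<Rightarrow> 'v set set \<Rightarrow> bool" where
  "sparse k l F \<longleftrightarrow> (\<forall>F'\<subseteq>F. int (card F') \<le> max (k * int (card (\<Union>F')) - l) 0)"

definition tight :: "int \<Rightarrow> int \<Rightarrow> 'v set \<Rightarrow> 'v set set \<Rightarrow> bool" where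
  "tight k l V F \<longleftrightarrow> sparse k l F \<and> int (card F) = max (k * int (card V) - l) 0"

text \<open>Dimensions have to be quantified inside a formula, so the space of real vectors
  indexed by a finite set \<open>A\<close> is the subspace of \<open>'a \<Rightarrow>\<^sub>0 real\<close> of all vectors supported
  on \<open>A\<close>; Euclidean \<open>p\<close>-space is \<open>coord_space {..<p}\<close>. The library's \<open>convex hull\<close>,
  \<open>polytope\<close>, \<open>face_of\<close>, \<open>linear\<close> apply to this type as they stand.\<close>

definition coord_space :: "'a set \<Rightarrow> ('a \<Rightarrow>\<^sub>0 real) set" where
  "coord_space A = {x. Poly_Mapping.keys x \<subseteq> A}"

definition incidence_vec :: "'a set \<Rightarrow> ('a \<Rightarrow>\<^sub>0 real)" where
  "incidence_vec F = Abs_poly_mapping (indicator F)"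

lemma lookup_incidence_vec:
  assumes "finite F"
  shows "Poly_Mapping.lookup (incidence_vec F) e = (if e \<in> F then 1 else 0)"
proof -
  have "finite {x. (indicator F x :: real) \<noteq> 0}"
    using assms by (simp add: indicator_def)
  then show ?thesis
    by (simp add: incidence_vec_def indicator_def)
qed

text \<open>The library restricts \<open>aff_dim\<close>, and hence \<open>facet_of\<close>, to the class
  \<open>euclidean_space\<close>, to which \<open>'a \<Rightarrow>\<^sub>0 real\<close> does not belong. The next two definitions
  are theirs with a weaker type class. They are meant for subsets of some
  \<open>coord_space A\<close> with \<open>A\<close> finite, where the set \<open>B\<close> below is necessarily finite.\<close>

definition affine_dim :: "'a::real_vector set \<Rightarrow> int" where
  "affine_dim S = (SOME d :: int.
     \<exists>B. affine hull B = affine hull S \<and> \<not> affine_dependent B \<and> of_nat (card B) = d + 1)"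

lemma affine_dim_eq_aff_dim: "affine_dim S = aff_dim (S :: 'a::euclidean_space set)"
  by (simp add: affine_dim_def aff_dim_def)

text \<open>A polytope has only finitely many faces, so the cardinality of this set is
  its number of facets.\<close>

definition facets :: "'a::real_vector set \<Rightarrow> 'a set set" where
  "facets S = {F. F face_of S \<and> F \<noteq> {} \<and> affine_dim F = affine_dim S - 1}"

lemma facets_eq_facet_of: "facets S = {F :: 'a::euclidean_space set. F facet_of S}"
  by (simp add: facets_def facet_of_def affine_dim_eq_aff_dim)

lemma face_of_finite_convex_hull:
  fixes v :: "'a::real_vector set"
  assumes "finite v" and F: "F face_of convex hull v"
  shows "F = convex hull (v \<inter> F)"
proof
  show "convex hull (v \<inter> F) \<subseteq> F"
    using F by (simp add: face_of_imp_convex hull_minimal)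
  show "F \<subseteq> convex hull (v \<inter> F)"
  proof
    fix x assume "x \<in> F"
    then have "x \<in> convex hull v"
      using F face_of_imp_subset by blast
    then obtain u where u: "\<And>z. z \<in> v \<Longrightarrow> 0 \<le> u z" "sum u v = 1" "(\<Sum>z\<in>v. u z *\<^sub>R z) = x"
      using convex_hull_finite[OF assms(1)] by auto
    have inF: "w \<in> F" if w: "w \<in> v" "u w > 0" for w
    proof -
      have s1: "sum u (v - {w}) = 1 - u w"
        using u(2) w(1) assms(1) by (simp add: sum_diff1)
      have s2: "(\<Sum>z\<in>v - {w}. u z *\<^sub>R z) = x - u w *\<^sub>R w"
        using u(3) w(1) assms(1) by (simp add: sum_diff1)
      show ?thesis
      proof (cases "u w = 1")
        case True
        then have "\<forall>z\<in>v - {w}. u z = 0"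
          using s1 u(1) assms(1) by (subst sum_nonneg_eq_0_iff[symmetric]) auto
        then have "x = w"
          using s2 True by simp
        then show ?thesis
          using \<open>x \<in> F\<close> by simp
      next
        case False
        have "sum u (v - {w}) \<ge> 0"
          using u(1) by (intro sum_nonneg) auto
        with s1 False have lt: "u w < 1"
          by simp
        define y where "y = (\<Sum>z\<in>v - {w}. (u z / (1 - u w)) *\<^sub>R z)"
        have "y \<in> convex hull v"
          unfolding y_def
        proof (rule convex_sum)
          show "(\<Sum>z\<in>v - {w}. u z / (1 - u w)) = 1"
            using s1 lt by (simp add: sum_divide_distrib[symmetric])
        qed (use assms(1) u(1) lt in \<open>auto intro: hull_inc\<close>)
        have "y = (1 / (1 - u w)) *\<^sub>R (\<Sum>z\<in>v - {w}. u z *\<^sub>R z)"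
          by (simp add: y_def scaleR_sum_right)
        then have "(1 - u w) *\<^sub>R y = x - u w *\<^sub>R w"
          using s2 lt by simp
        then have x: "x = (1 - (1 - u w)) *\<^sub>R w + (1 - u w) *\<^sub>R y"
          by simp
        show ?thesis
        proof (cases "y = w")
          case True
          then have "x = w"
            using x by (simp add: scaleR_left_distrib[symmetric])
          then show ?thesis
            using \<open>x \<in> F\<close> by simp
        next
          case False
          then have "x \<in> open_segment w y"
            unfolding in_segment using x w(2) lt by (intro conjI exI[of _ "1 - u w"]) auto
          then show ?thesis
            using face_ofD[OF F] \<open>x \<in> F\<close> \<open>y \<in> convex hull v\<close> hull_inc[OF w(1)] by blast
        qed
      qed
    qed
    have z: "u z = 0" if "z \<in> v - v \<inter> F" for z
      using inF[of z] u(1)[of z] that by fastforce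
    have "sum u (v \<inter> F) = 1"
      using u(2) z assms(1) sum.mono_neutral_left[of v "v \<inter> F" u] by simp
    moreover have "(\<Sum>z\<in>v \<inter> F. u z *\<^sub>R z) = x"
      using u(3) z assms(1) sum.mono_neutral_left[of v "v \<inter> F" "\<lambda>z. u z *\<^sub>R z"] by simp
    ultimately show "x \<in> convex hull (v \<inter> F)"
      using u(1) assms(1) by (subst convex_hull_finite) auto
  qed
qed

lemma finite_facets:
  assumes "polytope S"
  shows "finite (facets S)"
proof -
  obtain v where v: "finite v" "S = convex hull v"
    using assms by (auto simp: polytope_def)
  then have "facets S \<subseteq> (hull) convex ` Pow v"
    using face_of_finite_convex_hull by (fastforce simp: facets_def)
  then show ?thesis
    using v(1) finite_subset by blast
qed

definition tight_polytope :: "int \<Rightarrow> int \<Rightarrow> 'v set \<Rightarrow> 'v set set \<Rightarrow> ('v set \<Rightarrow>\<^sub>0 real) set" where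
  "tight_polytope k l V E = convex hull (incidence_vec ` {F. F \<subseteq> E \<and> tight k l V F})"

text \<open>\<open>Q\<close>, in dimension \<open>p\<close>, is an extended formulation of \<open>P\<close>, in the space with
  coordinates \<open>A\<close>. A projection is a linear map of the former space onto the latter;
  only the values of \<open>\<pi>\<close> on \<open>coord_space {..<p}\<close> matter, and every linear map defined
  there extends to the whole type.\<close>

definition extended_formulation ::
    "'a set \<Rightarrow> ('a \<Rightarrow>\<^sub>0 real) set \<Rightarrow> nat \<Rightarrow> (nat \<Rightarrow>\<^sub>0 real) set \<Rightarrow> bool" where
  "extended_formulation A P p Q \<longleftrightarrow>
     card A \<le> p \<and> polytope Q \<and> Q \<subseteq> coord_space {..<p} \<and>
     (\<exists>\<pi>. linear \<pi> \<and> \<pi> ` coord_space {..<p} = coord_space A \<and> \<pi> ` Q = P)"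

end

theory Submission
  imports Defs
begin

text \<open>Because \<open>l \<le> k\<close>, an edge set \<open>F\<close> is tight iff for every root \<open>r\<close> it has an orientation with
  in-degree \<open>k - l\<close> at \<open>r\<close> and \<open>k\<close> at every other vertex: such an orientation exists by
  Hall's theorem with capacities, and conversely counting heads inside a vertex set containing \<open>r\<close>
  gives the sparsity bound for that set. The extended formulation has a variable \<open>x e \<le> 1\<close> for
  each edge and, for each root \<open>r\<close> separately, a fractional orientation \<open>y r e u \<ge> 0\<close> of \<open>x\<close>.
  Its projection satisfies the sparsity inequalities, and uncrossing shows that these describe an
  integral polytope. Every facet is cut out by one of the \<open>|E| + 2|V||E|\<close> inequalities.\<close>

section \<open>Facets of pointed polyhedra\<close>

text \<open>\<open>pointed\<close> makes the recession cone trivial: no nonzero direction of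
  \<open>L\<close> keeps every \<open>g i\<close> from increasing. This is boundedness, stronger
  than the absence of lines, so \<open>feasible\<close> turns out to be a polytope. Equations are
  kept in \<open>L\<close>, so that only the inequalities in \<open>I\<close> count as candidates
  for facets.\<close>

locale pointed_polyhedron =
  fixes L :: "'a::real_vector set" and I :: "'i set"
    and g :: "'i \<Rightarrow> 'a \<Rightarrow> real" and b :: "'i \<Rightarrow> real"
  assumes affine_L: "affine L" and finite_I: "finite I"
    and linear_g: "i \<in> I \<Longrightarrow> linear (g i)"
    and pointed: "x \<in> L \<Longrightarrow> x + d \<in> L \<Longrightarrow> (\<And>i. i \<in> I \<Longrightarrow> g i d \<le> 0) \<Longrightarrow> d = 0"
begin

definition feasible :: "'a set" where
  "feasible = {x \<in> L. \<forall>i\<in>I. g i x \<le> b i}"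

definition active :: "'a \<Rightarrow> 'i set" where
  "active x = {i \<in> I. g i x = b i}"

text \<open>Basic feasible solutions: the active constraints leave no direction of \<open>L\<close>
  free.\<close>

definition vertices :: "'a set" where
  "vertices = {v \<in> feasible. \<forall>d. v + d \<in> L \<longrightarrow> (\<forall>i\<in>active v. g i d = 0) \<longrightarrow> d = 0}"

lemma g_add: "i \<in> I \<Longrightarrow> g i (x + y) = g i x + g i y"
  and g_diff: "i \<in> I \<Longrightarrow> g i (x - y) = g i x - g i y"
  and g_scale: "i \<in> I \<Longrightarrow> g i (t *\<^sub>R x) = t * g i x"
  and g_uminus: "i \<in> I \<Longrightarrow> g i (- x) = - g i x"
  using linear_g[of i] by (simp_all add: linear_add linear_diff linear_scale linear_neg)

lemma line_in_L:
  assumes "x \<in> L" "x + d \<in> L"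
  shows "x + t *\<^sub>R d \<in> L"
proof -
  have "(1 - t) *\<^sub>R x + t *\<^sub>R (x + d) \<in> L"
    using affine_L assms unfolding affine_def by simp
  then show ?thesis by (simp add: algebra_simps)
qed

lemma convex_feasible: "convex feasible"
proof (rule convexI)
  fix x y and u v :: real
  assume *: "x \<in> feasible" "y \<in> feasible" "0 \<le> u" "0 \<le> v" "u + v = 1"
  have "u *\<^sub>R x + v *\<^sub>R y \<in> L"
    using affine_L * by (simp add: affine_def feasible_def)
  moreover have "g i (u *\<^sub>R x + v *\<^sub>R y) \<le> b i" if "i \<in> I" for i
    using that * convex_bound_le[of "g i x" "b i" "g i y" u v]
    by (simp add: feasible_def g_add g_scale)
  ultimately show "u *\<^sub>R x + v *\<^sub>R y \<in> feasible"
    by (simp add: feasible_def)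
qed

text \<open>The ratio test of the simplex method. By \<open>pointed\<close> some constraint
  increases along \<open>d\<close>, and the first such constraint to become active limits the step.
  It is slack at \<open>x\<close>, because active constraints are constant along \<open>d\<close>;
  so the step is positive and enlarges the active set.\<close>

lemma max_step:
  assumes x: "x \<in> feasible" and d: "x + d \<in> L" "d \<noteq> 0"
    and act: "\<And>i. i \<in> active x \<Longrightarrow> g i d = 0"
  obtains t where "t > 0" "x + t *\<^sub>R d \<in> feasible" "active x \<subset> active (x + t *\<^sub>R d)"
proof -
  define J where "J = {i \<in> I. g i d > 0}"
  have xL: "x \<in> L" and xb: "\<And>i. i \<in> I \<Longrightarrow> g i x \<le> b i"
    using x by (auto simp: feasible_def)
  have "J \<noteq> {}" "finite J"
    using pointed[OF xL d(1)] d(2) finite_I by (force simp: J_def)+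
  define t where "t = Min ((\<lambda>i. (b i - g i x) / g i d) ` J)"
  have t_le: "t * g i d \<le> b i - g i x" if "i \<in> J" for i
  proof -
    have "t \<le> (b i - g i x) / g i d"
      unfolding t_def using that \<open>finite J\<close> by (intro Min_le) auto
    then show ?thesis using that by (simp add: J_def field_simps)
  qed
  have "t \<in> (\<lambda>i. (b i - g i x) / g i d) ` J"
    unfolding t_def using \<open>J \<noteq> {}\<close> \<open>finite J\<close> by (intro Min_in) auto
  then obtain j where j: "j \<in> J" "t = (b j - g j x) / g j d" by auto
  have jI: "j \<in> I" "g j d > 0" using j(1) by (auto simp: J_def)
  have jn: "j \<notin> active x" using act[of j] jI(2) by auto
  then have "g j x < b j" using xb[OF jI(1)] jI(1) by (auto simp: active_def)
  then have t: "t > 0" using j jI by simp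
  have eq: "g i (x + t *\<^sub>R d) = g i x + t * g i d" if "i \<in> I" for i
    using that by (simp add: g_add g_scale)
  have "g i (x + t *\<^sub>R d) \<le> b i" if i: "i \<in> I" for i
  proof (cases "i \<in> J")
    case True
    then show ?thesis using t_le[OF True] eq[OF i] by simp
  next
    case False
    then have "t * g i d \<le> 0" using i t by (simp add: J_def mult_nonneg_nonpos)
    then show ?thesis using xb[OF i] eq[OF i] by simp
  qed
  then have "x + t *\<^sub>R d \<in> feasible"
    using line_in_L[OF xL d(1)] by (simp add: feasible_def)
  moreover have "active x \<subseteq> active (x + t *\<^sub>R d)"
    using act by (auto simp: active_def eq)
  moreover have "j \<in> active (x + t *\<^sub>R d)"
    using jI j(2) eq[OF jI(1)] by (simp add: active_def)
  ultimately show thesis using that[of t] t jn by blast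
qed

lemma small_step:
  assumes "x \<in> feasible" "x + d \<in> L" "\<And>i. i \<in> active x \<Longrightarrow> g i d = 0"
  obtains t where "t > 0" "x + t *\<^sub>R d \<in> feasible"
proof (cases "d = 0")
  case True
  then show ?thesis using that[of 1] assms(1) by simp
next
  case False
  then show ?thesis using max_step[OF assms(1,2) False assms(3)] that by blast
qed

text \<open>A vertex is determined by its active set: the difference of two vertices with the same
  active set is a direction of \<open>L\<close> annihilated by all constraints of that set.\<close>

lemma finite_vertices: "finite vertices"
proof -
  have "inj_on active vertices"
  proof (rule inj_onI)
    fix v w assume *: "v \<in> vertices" "w \<in> vertices" "active v = active w"
    have "w - v = 0"
    proof -
      have "v + (w - v) \<in> L" using * by (simp add: vertices_def feasible_def)
      moreover have "g i (w - v) = 0" if "i \<in> active v" for i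
        using that *(3) that[unfolded *(3)] by (simp add: active_def g_diff)
      ultimately show ?thesis using *(1) unfolding vertices_def by blast
    qed
    then show "v = w" by simp
  qed
  moreover have "active ` vertices \<subseteq> Pow I" by (auto simp: active_def)
  ultimately show ?thesis using finite_I by (meson finite_Pow_iff inj_on_finite)
qed

text \<open>Induction on the number of slack constraints. A point that is no vertex has a free
  direction \<open>d\<close>; moving along \<open>d\<close> and along \<open>- d\<close> until a new
  constraint becomes active gives two points with fewer slack constraints, and the given point lies
  between them.\<close>

lemma feasible_eq_hull: "feasible = convex hull vertices"
proof
  show "convex hull vertices \<subseteq> feasible"
    by (intro hull_minimal convex_feasible) (auto simp: vertices_def)
  have "x \<in> convex hull vertices" if "x \<in> feasible" for x
    using that
  proof (induction "card (I - active x)" arbitrary: x rule: less_induct)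
    case less
    show ?case
    proof (cases "x \<in> vertices")
      case True
      then show ?thesis by (rule hull_inc)
    next
      case False
      then obtain d where d: "x + d \<in> L" "\<And>i. i \<in> active x \<Longrightarrow> g i d = 0" "d \<noteq> 0"
        using less.prems by (auto simp: vertices_def)
      have smaller: "card (I - active y) < card (I - active x)" if "active x \<subset> active y" for y
      proof (rule psubset_card_mono)
        show "I - active y \<subset> I - active x"
          using that by (auto simp: active_def)
      qed (use finite_I in simp)
      obtain s where s: "s > 0" "x + s *\<^sub>R d \<in> feasible" "active x \<subset> active (x + s *\<^sub>R d)"
        using max_step[OF less.prems d(1,3,2)] by blast
      have "x + - d \<in> L"
        using line_in_L[OF _ d(1), of "-1"] less.prems by (simp add: feasible_def)
      moreover have "g i (- d) = 0" if "i \<in> active x" for i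
        using d(2)[OF that] that by (simp add: active_def g_uminus)
      ultimately obtain t where t: "t > 0" "x + t *\<^sub>R (- d) \<in> feasible"
          "active x \<subset> active (x + t *\<^sub>R (- d))"
        using max_step[OF less.prems, of "- d"] d(3) by (metis neg_equal_0_iff_equal)
      have one: "t / (s + t) + s / (s + t) = 1"
        using s(1) t(1) by (simp add: add_divide_distrib[symmetric])
      have "x + s *\<^sub>R d \<in> convex hull vertices" "x + t *\<^sub>R (- d) \<in> convex hull vertices"
        using less.hyps[OF smaller] s t by blast+
      then have "(t / (s + t)) *\<^sub>R (x + s *\<^sub>R d) + (s / (s + t)) *\<^sub>R (x + t *\<^sub>R (- d))
          \<in> convex hull vertices"
        using s(1) t(1) one by (intro convexD[OF convex_convex_hull]) auto
      moreover have "(t / (s + t)) *\<^sub>R (x + s *\<^sub>R d) + (s / (s + t)) *\<^sub>R (x + t *\<^sub>R (- d))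
          = (t / (s + t) + s / (s + t)) *\<^sub>R x"
        by (simp add: algebra_simps)
      ultimately show ?thesis using one by simp
    qed
  qed
  then show "feasible \<subseteq> convex hull vertices" by blast
qed

lemma polytope_feasible: "polytope feasible"
  using finite_vertices feasible_eq_hull by (auto simp: polytope_def)

section \<open>Faces and facets in terms of active constraints\<close>

text \<open>A substitute for a relative interior point of \<open>F\<close>. The constraints are
  treated one at a time: a midpoint is active only where both ends are, so averaging with a point at
  which \<open>j\<close> is slack removes \<open>j\<close> and adds nothing.\<close>

lemma face_strict_point:
  assumes F: "F face_of feasible" "F \<noteq> {}"
  obtains x where "x \<in> F" "\<And>i. i \<in> active x \<Longrightarrow> (\<forall>z\<in>F. i \<in> active z)"
proof -
  have FQ: "F \<subseteq> feasible" using F(1) by (rule face_of_imp_subset)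
  have cF: "convex F" using F(1) by (rule face_of_imp_convex)
  have "\<exists>x\<in>F. \<forall>i\<in>J. i \<in> active x \<longrightarrow> (\<forall>z\<in>F. i \<in> active z)" if "finite J" "J \<subseteq> I" for J
    using that
  proof (induction J rule: finite_induct)
    case empty
    then show ?case using F(2) by auto
  next
    case (insert j J)
    then obtain x where x: "x \<in> F" "\<forall>i\<in>J. i \<in> active x \<longrightarrow> (\<forall>z\<in>F. i \<in> active z)"
      by auto
    show ?case
    proof (cases "\<forall>z\<in>F. j \<in> active z")
      case True
      then show ?thesis using x by auto
    next
      case False
      then obtain z where z: "z \<in> F" "j \<notin> active z" by auto
      define w where "w = (1/2) *\<^sub>R x + (1/2) *\<^sub>R z"
      have wF: "w \<in> F" unfolding w_def by (rule convexD[OF cF x(1) z(1)]) auto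
      have sub: "i \<in> active x \<and> i \<in> active z" if "i \<in> active w" for i
      proof -
        have i: "i \<in> I" using that by (simp add: active_def)
        have "g i x \<le> b i" "g i z \<le> b i"
          using FQ x(1) z(1) i by (auto simp: feasible_def)
        moreover have "g i w = b i" using that by (simp add: active_def)
        ultimately show ?thesis using i by (simp add: active_def w_def g_add g_scale)
      qed
      then show ?thesis using wF x(2) z(2) by blast
    qed
  qed
  from this[OF finite_I order_refl] obtain x
    where "x \<in> F" "\<forall>i\<in>I. i \<in> active x \<longrightarrow> (\<forall>z\<in>F. i \<in> active z)" by auto
  then show thesis using that[of x] by (auto simp: active_def)
qed

text \<open>Every constraint active at a strict point \<open>x\<close> of \<open>F\<close> is active
  at \<open>z\<close> too, so the segment from \<open>z\<close> to \<open>x\<close> can be prolonged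
  a little beyond \<open>x\<close> inside \<open>feasible\<close>. Then \<open>x\<close> is interior
  to a segment, and the face property puts its end \<open>z\<close> into \<open>F\<close>.\<close>

lemma mem_face:
  assumes F: "F face_of feasible" "F \<noteq> {}" and z: "z \<in> feasible"
    and act: "\<And>i. i \<in> I \<Longrightarrow> \<forall>y\<in>F. i \<in> active y \<Longrightarrow> i \<in> active z"
  shows "z \<in> F"
proof -
  obtain x where x: "x \<in> F" "\<And>i. i \<in> active x \<Longrightarrow> (\<forall>z\<in>F. i \<in> active z)"
    using face_strict_point[OF F] by blast
  have xQ: "x \<in> feasible" using face_of_imp_subset[OF F(1)] x(1) by auto
  show ?thesis
  proof (cases "z = x")
    case True
    then show ?thesis using x(1) by simp
  next
    case False
    have L: "x + (x - z) \<in> L"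
      using line_in_L[of x "z - x" "-1"] xQ z by (simp add: feasible_def algebra_simps)
    have "g i (x - z) = 0" if "i \<in> active x" for i
    proof -
      have "i \<in> active z" using act x(2) that by (simp add: active_def)
      then show ?thesis using that by (simp add: active_def g_diff)
    qed
    then obtain t where t: "t > 0" "x + t *\<^sub>R (x - z) \<in> feasible"
      using small_step[OF xQ L] by blast
    define y where "y = x + t *\<^sub>R (x - z)"
    \<comment> \<open>The weights come from solving \<open>y = x + t *\<^sub>R (x - z)\<close> for
      \<open>x\<close>.\<close>
    have "x = (1 - 1 / (1 + t)) *\<^sub>R z + (1 / (1 + t)) *\<^sub>R y"
    proof -
      have e: "1 / (1 + t) + t / (1 + t) = 1" "1 - 1 / (1 + t) - t / (1 + t) = 0"
        using t(1) by (simp_all add: field_simps)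
      have "(1 - 1 / (1 + t)) *\<^sub>R z + (1 / (1 + t)) *\<^sub>R y
          = (1 / (1 + t) + t / (1 + t)) *\<^sub>R x + (1 - 1 / (1 + t) - t / (1 + t)) *\<^sub>R z"
        by (simp add: y_def algebra_simps)
      then show ?thesis using e by simp
    qed
    moreover have "z \<noteq> y"
    proof
      assume "z = y"
      then have "(1 + t) *\<^sub>R (x - z) = 0" by (simp add: y_def algebra_simps)
      then show False using t(1) False by simp
    qed
    ultimately have "x \<in> open_segment z y"
      unfolding in_segment using t(1) by (intro conjI exI[of _ "1 / (1 + t)"]) auto
    then show ?thesis using face_ofD[OF F(1)] x(1) z t(2) y_def by blast
  qed
qed

lemma affine_active: "i \<in> I \<Longrightarrow> affine {z. g i z = c}"
  unfolding affine_def by (auto simp: g_add g_scale distrib_right[symmetric])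

text \<open>By the dimension gap and \<open>mem_face\<close>, some \<open>i\<close> is active on
  \<open>F\<close> but not on all of \<open>feasible\<close>. A point \<open>z\<close> outside
  \<open>F\<close> at which \<open>i\<close> is active would lie outside the affine hull of
  \<open>F\<close>; together with \<open>x0\<close>, which is off the hyperplane of
  \<open>i\<close>, it would raise the dimension by two, whereas \<open>feasible\<close> exceeds
  \<open>F\<close> by one only.\<close>

lemma facet_eq:
  assumes F: "F \<in> facets feasible" and W: "finite W" "feasible \<subseteq> span W"
  shows "\<exists>i\<in>I. F = {z \<in> feasible. i \<in> active z}"
proof -
  have face: "F face_of feasible" and ne: "F \<noteq> {}"
    and dim: "affine_dim F = affine_dim feasible - 1"
    using F by (auto simp: facets_def)
  have FQ: "F \<subseteq> feasible" using face by (rule face_of_imp_subset)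
  have "\<not> feasible \<subseteq> F" using dim FQ by auto
  then obtain x0 i where i: "i \<in> I" "\<forall>z\<in>F. i \<in> active z" and x0: "x0 \<in> feasible" "i \<notin> active x0"
    using mem_face[OF face ne] by blast
  \<comment> \<open>\<open>affine_dim\<close> is a choice, so its defining property is available
    only once a witness has been exhibited.\<close>
  have basis: "\<exists>B. affine hull B = affine hull S \<and> \<not> affine_dependent B \<and>
      of_nat (card B) = affine_dim S + 1" for S :: "'a set"
  proof -
    obtain B where B: "\<not> affine_dependent B" "affine hull S = affine hull B"
      using affine_basis_exists[of S] by auto
    show ?thesis
      unfolding affine_dim_def
      by (rule someI[where x = "int (card B) - 1"]) (use B in auto)
  qed
  obtain B where B: "affine hull B = affine hull F" "\<not> affine_dependent B"
      "of_nat (card B) = affine_dim F + 1" using basis by blast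
  obtain C where C: "affine hull C = affine hull feasible" "\<not> affine_dependent C"
      "of_nat (card C) = affine_dim feasible + 1" using basis by blast
  have card: "card C = card B + 1" using B(3) C(3) dim by linarith
  \<comment> \<open>An infinite set has \<open>card\<close> 0, so a positive cardinality proves
    \<open>C\<close> finite.\<close>
  then have finC: "finite C" using card_ge_0_finite[of C] by linarith
  have "C \<noteq> {}" using card by auto
  then obtain c C' where c: "C = insert c C'" "c \<notin> C'" by (meson mk_disjoint_insert all_not_in_conv)
  have "B \<noteq> {}" using B(1) ne by (metis affine_hull_eq_empty)
  then obtain a B' where a: "B = insert a B'" "a \<notin> B'" by (meson mk_disjoint_insert all_not_in_conv)
  \<comment> \<open>\<open>D\<close>, and later \<open>A\<close>, span the direction spaces of the
    affine hulls of \<open>feasible\<close> and \<open>F\<close>: one basis point is translated to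
    the origin.\<close>
  define D where "D = (\<lambda>x. - c + x) ` C'"
  have hullQ: "affine hull feasible = (\<lambda>x. c + x) ` span D"
    unfolding C(1)[symmetric] c(1) D_def by (rule affine_hull_insert_span_gen)
  have diffQ: "x - y \<in> span D" if xy: "x \<in> affine hull feasible" "y \<in> affine hull feasible" for x y
  proof -
    obtain x' y' where "x = c + x'" "y = c + y'" "x' \<in> span D" "y' \<in> span D"
      using xy unfolding hullQ by auto
    then show ?thesis by (simp add: span_diff)
  qed
  have finD: "finite D" "card D \<le> card B"
    using finC c card card_image_le[of C' "\<lambda>x. - c + x"] by (auto simp: D_def)
  define A where "A = (\<lambda>x. - a + x) ` B'"
  have hullF: "affine hull F = (\<lambda>x. a + x) ` span A"
    unfolding B(1)[symmetric] a(1) A_def by (rule affine_hull_insert_span_gen)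
  have indA: "independent A"
    using B(2) a affine_dependent_iff_dependent[of a B'] by (simp add: A_def)
  have hull_sub: "affine hull F \<subseteq> affine hull feasible" using FQ by (rule hull_mono)
  have aF: "a \<in> affine hull F" using B(1) a(1) by (metis hull_inc insertI1)
  have BF: "B \<subseteq> affine hull F" using B(1) hull_subset[of B affine] by simp
  have AD: "A \<subseteq> span D"
  proof
    fix x assume "x \<in> A"
    then obtain y where y: "y \<in> B" "x = y - a" by (auto simp: A_def a(1))
    then show "x \<in> span D" using diffQ[of y a] BF aF hull_sub by blast
  qed
  \<comment> \<open>Finiteness passes from \<open>D\<close> to the independent set \<open>A\<close>
    inside its span, and from there to \<open>B\<close>.\<close>
  have finA: "finite A" using independent_span_bound[OF finD(1) indA AD] by simp
  have "finite B'" using finA unfolding A_def by (rule finite_imageD) (simp add: inj_on_def)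
  then have cardA: "card A + 1 = card B"
    using a by (simp add: A_def card_image inj_on_def)
  have gF: "g i z = b i" if "z \<in> affine hull F" for z
  proof -
    have "F \<subseteq> {z. g i z = b i}" using i by (auto simp: active_def)
    then have "affine hull F \<subseteq> {z. g i z = b i}" by (intro hull_minimal affine_active i(1))
    then show ?thesis using that by auto
  qed
  have "F = {z \<in> feasible. i \<in> active z}"
  proof (intro equalityI subsetI)
    fix z assume "z \<in> F"
    then show "z \<in> {z \<in> feasible. i \<in> active z}" using i FQ by auto
  next
    fix z assume "z \<in> {z \<in> feasible. i \<in> active z}"
    then have z: "z \<in> feasible" "g i z = b i" by (auto simp: active_def)
    show "z \<in> F"
    proof (rule ccontr)
      assume "z \<notin> F"
      \<comment> \<open>Constraints active on all of \<open>F\<close> are equations on its affine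
        hull, so a feasible point of that hull meets the hypothesis of
        \<open>mem_face\<close>.\<close>
      have znF: "z \<notin> affine hull F"
      proof
        assume zh: "z \<in> affine hull F"
        have "z \<in> F"
        proof (rule mem_face[OF face ne z(1)])
          fix j assume j: "j \<in> I" "\<forall>y\<in>F. j \<in> active y"
          then have "F \<subseteq> {z. g j z = b j}" by (auto simp: active_def)
          then have "affine hull F \<subseteq> {z. g j z = b j}" by (intro hull_minimal affine_active j(1))
          then show "j \<in> active z" using zh j(1) by (auto simp: active_def)
        qed
        then show False using \<open>z \<notin> F\<close> by simp
      qed
      have zA: "z - a \<notin> span A"
      proof
        assume "z - a \<in> span A"
        then have "a + (z - a) \<in> affine hull F" unfolding hullF by blast
        then show False using znF by simp
      qed
      have ga: "g i a = b i" using gF aF .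
      have "insert (z - a) A \<subseteq> {y. g i y = 0}"
        using z(2) ga gF BF i(1) by (auto simp: A_def g_diff a(1) g_add g_uminus)
      moreover have "subspace {y. g i y = 0}"
        using i(1) linear_subspace_kernel[OF linear_g[OF i(1)]] by simp
      ultimately have "span (insert (z - a) A) \<subseteq> {y. g i y = 0}" by (rule span_minimal)
      moreover have "g i (x0 - a) \<noteq> 0"
        using x0 i(1) ga by (auto simp: active_def g_diff)
      ultimately have xA: "x0 - a \<notin> span (insert (z - a) A)" by blast
      have ind: "independent (insert (x0 - a) (insert (z - a) A))"
        using indA zA xA by (simp add: independent_insertI)
      have "insert (x0 - a) (insert (z - a) A) \<subseteq> span D"
        using AD diffQ[of x0 a] diffQ[of z a] aF hull_sub x0(1) z(1)
        by (metis hull_inc insert_subset subsetD)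
      then have "card (insert (x0 - a) (insert (z - a) A)) \<le> card D"
        using independent_span_bound[OF finD(1) ind] by simp
      moreover have "card (insert (x0 - a) (insert (z - a) A)) = card A + 2"
        using zA xA finA by (metis add_2_eq_Suc' card_insert_disjoint finite_insert span_base)
      ultimately show False using finD(2) cardA by simp
    qed
  qed
  then show ?thesis using i(1) by blast
qed

lemma card_facets_le: "card (facets feasible) \<le> card I"
proof -
  have "feasible \<subseteq> span vertices"
    unfolding feasible_eq_hull by (rule convex_hull_subset_span)
  then have "facets feasible \<subseteq> (\<lambda>i. {z \<in> feasible. i \<in> active z}) ` I"
    using facet_eq[OF _ finite_vertices] by blast
  then show ?thesis using finite_I by (rule surj_card_le[rotated])
qed

end

section \<open>Orientations of tight graphs\<close>

text \<open>Rado's deletion argument, by induction on the total size of the sets \<open>A e\<close>.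
  If all are singletons, \<open>h\<close> is forced and the Hall condition for a fibre bounds its
  size. Otherwise, of two elements \<open>u\<close>, \<open>v\<close> of some \<open>A e\<close>, at
  least one can be removed without destroying the condition.\<close>

lemma capacitated_hall:
  fixes A :: "'e \<Rightarrow> 'v set" and c :: "'v \<Rightarrow> int"
  assumes F: "finite F" and A: "\<And>e. e \<in> F \<Longrightarrow> finite (A e)" and c: "\<And>u. 0 \<le> c u"
    and hall: "\<And>F'. F' \<subseteq> F \<Longrightarrow> int (card F') \<le> sum c (\<Union>(A ` F'))"
  shows "\<exists>h. (\<forall>e\<in>F. h e \<in> A e) \<and> (\<forall>u. int (card {e \<in> F. h e = u}) \<le> c u)"
  using A hall
proof (induction "\<Sum>e\<in>F. card (A e)" arbitrary: A rule: less_induct)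
  case less
  have ne: "A e \<noteq> {}" if "e \<in> F" for e
    using less.prems(2)[of "{e}"] that by auto
  show ?case
  proof (cases "\<exists>e\<in>F. \<exists>u\<in>A e. \<exists>v\<in>A e. u \<noteq> v")
    case False
    define h where "h e = (SOME u. u \<in> A e)" for e
    have h: "h e \<in> A e" if "e \<in> F" for e
      unfolding h_def using ne[OF that] by (simp add: some_in_eq)
    have "int (card {e \<in> F. h e = u}) \<le> c u" for u
    proof -
      have "\<Union>(A ` {e \<in> F. h e = u}) \<subseteq> {u}" using False h by blast
      then have "sum c (\<Union>(A ` {e \<in> F. h e = u})) \<le> sum c {u}"
        using c by (intro sum_mono2) auto
      then show ?thesis using less.prems(2)[of "{e \<in> F. h e = u}"] by simp
    qed
    then show ?thesis using h by blast
  next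
    case True
    then obtain e u v where e: "e \<in> F" and uv: "u \<in> A e" "v \<in> A e" "u \<noteq> v" by blast
    have dec: ?thesis if w: "w \<in> A e"
      and hall': "\<And>F'. F' \<subseteq> F \<Longrightarrow> int (card F') \<le> sum c (\<Union>((A(e := A e - {w})) ` F'))" for w
    proof -
      define A' where "A' = A(e := A e - {w})"
      have "(\<Sum>e\<in>F. card (A' e)) < (\<Sum>e\<in>F. card (A e))"
      proof (rule sum_strict_mono_ex1)
        show "\<forall>x\<in>F. card (A' x) \<le> card (A x)"
          using less.prems(1) by (auto simp: A'_def intro: card_mono)
        show "\<exists>x\<in>F. card (A' x) < card (A x)"
          using e card_Diff1_less[OF less.prems(1)[OF e] w]
          by (intro bexI[of _ e]) (simp_all only: A'_def fun_upd_same)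
      qed (rule F)
      moreover have "finite (A' x)" if "x \<in> F" for x using less.prems(1) that by (auto simp: A'_def)
      ultimately have "\<exists>h. (\<forall>e\<in>F. h e \<in> A' e) \<and> (\<forall>u. int (card {e \<in> F. h e = u}) \<le> c u)"
        using hall' by (intro less.hyps) (auto simp: A'_def)
      moreover have "A' x \<subseteq> A x" for x by (auto simp: A'_def)
      ultimately show ?thesis by blast
    qed
    show ?thesis
    proof (rule ccontr)
      assume contra: "\<not> ?thesis"
      \<comment> \<open>A family violating the condition after the removal of \<open>w\<close> must
        contain \<open>e\<close>; splitting off \<open>e\<close> leaves \<open>G\<close> and
        accounts for the \<open>+ 1\<close>.\<close>
      have viol: "\<exists>G. G \<subseteq> F - {e} \<and> int (card G) + 1 > sum c (\<Union>(A ` G) \<union> (A e - {w}))"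
        if w: "w \<in> A e" for w
      proof -
        have "\<not> (\<forall>F'\<subseteq>F. int (card F') \<le> sum c (\<Union>((A(e := A e - {w})) ` F')))"
        proof
          assume *: "\<forall>F'\<subseteq>F. int (card F') \<le> sum c (\<Union>((A(e := A e - {w})) ` F'))"
          show False
            by (rule notE[OF contra], rule dec[OF w], rule *[rule_format])
        qed
        then obtain F' where F': "F' \<subseteq> F" "int (card F') > sum c (\<Union>((A(e := A e - {w})) ` F'))"
          unfolding not_all not_imp not_le by blast
        have "e \<in> F'"
        proof (rule ccontr)
          assume "e \<notin> F'"
          then have "\<Union>((A(e := A e - {w})) ` F') = \<Union>(A ` F')" by auto
          then show False using less.prems(2)[OF F'(1)] F'(2) by simp
        qed
        then have "card F' = card (F' - {e}) + 1"
          using F F'(1) by (metis Suc_eq_plus1 card.remove finite_subset)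
        moreover have "\<Union>((A(e := A e - {w})) ` F') = \<Union>(A ` (F' - {e})) \<union> (A e - {w})"
          using \<open>e \<in> F'\<close> by auto
        ultimately show ?thesis using F' by (intro exI[of _ "F' - {e}"]) auto
      qed
      obtain G where G: "G \<subseteq> F - {e}" "int (card G) + 1 > sum c (\<Union>(A ` G) \<union> (A e - {u}))"
        using viol[OF uv(1)] by auto
      obtain H where H: "H \<subseteq> F - {e}" "int (card H) + 1 > sum c (\<Union>(A ` H) \<union> (A e - {v}))"
        using viol[OF uv(2)] by auto
      define X where "X = \<Union>(A ` G) \<union> (A e - {u})"
      define Y where "Y = \<Union>(A ` H) \<union> (A e - {v})"
      have finGH: "finite G" "finite H" using F G(1) H(1) by (auto intro: finite_subset)
      have fin: "finite X" "finite Y"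
        using finGH less.prems(1) e G(1) H(1) by (auto simp: X_def Y_def)
      \<comment> \<open>Since \<open>u \<noteq> v\<close>, the set \<open>X \<union> Y\<close>
        contains all of \<open>A e\<close>, so \<open>e\<close> can be counted in addition to
        \<open>G \<union> H\<close>. Modularity of \<open>sum c\<close> then contradicts the bounds
        \<open>sum c X \<le> card G\<close> and \<open>sum c Y \<le> card H\<close> given by the
        violators.\<close>
      have "int (card (insert e (G \<union> H))) \<le> sum c (\<Union>(A ` insert e (G \<union> H)))"
        using G H e by (intro less.prems(2)) auto
      also have "\<dots> \<le> sum c (X \<union> Y)"
        using uv fin c by (intro sum_mono2) (auto simp: X_def Y_def)
      finally have 1: "int (card (G \<union> H)) + 1 \<le> sum c (X \<union> Y)"
        using G(1) H(1) finGH by (subst (asm) card_insert_disjoint) auto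
      have "int (card (G \<inter> H)) \<le> sum c (\<Union>(A ` (G \<inter> H)))"
        using G H by (intro less.prems(2)) auto
      also have "\<dots> \<le> sum c (X \<inter> Y)"
        using fin c by (intro sum_mono2) (auto simp: X_def Y_def)
      finally have 2: "int (card (G \<inter> H)) \<le> sum c (X \<inter> Y)" .
      have "sum c (X \<union> Y) + sum c (X \<inter> Y) = sum c X + sum c Y"
        using fin by (rule sum.union_inter)
      moreover have "card (G \<union> H) + card (G \<inter> H) = card G + card H"
        using card_Un_Int[OF finGH] by simp
      ultimately show False using 1 2 G(2) H(2) unfolding X_def[symmetric] Y_def[symmetric] by linarith
    qed
  qed
qed

text \<open>Each edge offers its two ends as heads. The capacities on \<open>X\<close> add up to at
  least \<open>k * int (card X) - l\<close>, so sparsity yields the Hall condition; on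
  \<open>V\<close> they add up to exactly \<open>card F\<close>, which forces equality at every
  vertex.\<close>

lemma tight_orientation:
  assumes F: "\<And>e. e \<in> F \<Longrightarrow> e \<subseteq> V \<and> card e = 2" and V: "finite V"
    and kl: "1 \<le> k" "0 \<le> l" "l \<le> k" and tight: "tight k l V F" and r: "r \<in> V"
  shows "\<exists>h. (\<forall>e\<in>F. h e \<in> e) \<and>
    (\<forall>u\<in>V. int (card {e \<in> F. h e = u}) = (if u = r then k - l else k))"
proof -
  define c where "c u = (if u = r then k - l else k)" for u
  have c0: "0 \<le> c u" for u using kl by (simp add: c_def)
  have sum_c: "sum c X = k * int (card X) - (if r \<in> X then l else 0)" if "finite X" for X
  proof -
    have "sum c X = (\<Sum>u\<in>X. k - (if u = r then l else 0))"
      by (intro sum.cong) (auto simp: c_def)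
    then show ?thesis using that by (simp add: sum_subtractf)
  qed
  have finF: "finite F" using V F by (meson Pow_iff finite_Pow_iff rev_finite_subset subsetI)
  have "int (card F') \<le> sum c (\<Union>(id ` F'))" if F': "F' \<subseteq> F" for F'
  proof (cases "F' = {}")
    case False
    then obtain e where e: "e \<in> F'" by auto
    have fin: "finite (\<Union>F')" using F F' V by (meson Sup_least finite_subset subsetD)
    have "e \<subseteq> \<Union>F'" "card e = 2" using e F F' by auto
    then have "2 \<le> card (\<Union>F')" using fin by (metis card_mono)
    then have "k * 2 \<le> k * int (card (\<Union>F'))" using kl by (intro mult_left_mono) auto
    \<comment> \<open>Hence the maximum with 0 in the sparsity bound is its first argument.\<close>
    then have "l \<le> k * int (card (\<Union>F'))" using kl by linarith
    moreover have "int (card F') \<le> max (k * int (card (\<Union>F')) - l) 0"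
      using tight F' by (auto simp: tight_def sparse_def)
    ultimately show ?thesis using sum_c[OF fin] kl by (auto split: if_splits)
  qed simp
  then have "\<exists>h. (\<forall>e\<in>F. h e \<in> id e) \<and> (\<forall>u. int (card {e \<in> F. h e = u}) \<le> c u)"
    using finF F c0 by (intro capacitated_hall) (auto intro: card_ge_0_finite)
  then obtain h where h: "\<And>e. e \<in> F \<Longrightarrow> h e \<in> e" "\<And>u. int (card {e \<in> F. h e = u}) \<le> c u"
    by auto
  have "h ` F \<subseteq> V" using h(1) F by blast
  then have "card F = (\<Sum>u\<in>V. card {e \<in> F. h e = u})"
    using card_eq_sum sum.group[OF finF V, of h "\<lambda>_. 1::nat"] by simp
  moreover have "int (card F) = sum c V"
  proof -
    have "1 \<le> card V" using r V by (metis One_nat_def Suc_leI card_gt_0_iff empty_iff)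
    then have "k * 1 \<le> k * int (card V)" using kl by (intro mult_left_mono) auto
    then have "l \<le> k * int (card V)" using kl by linarith
    then show ?thesis using tight sum_c[OF V] r by (simp add: tight_def)
  qed
  ultimately have "(\<Sum>u\<in>V. c u - int (card {e \<in> F. h e = u})) = 0"
    by (simp add: sum_subtractf)
  then have "\<forall>u\<in>V. c u - int (card {e \<in> F. h e = u}) = 0"
    using V h(2) by (subst (asm) sum_nonneg_eq_0_iff) auto
  then show ?thesis using h(1) by (auto simp: c_def)
qed

section \<open>Integrality of the sparsity inequalities\<close>

lemma lookup_scaleR [simp]:
  "Poly_Mapping.lookup (r *\<^sub>R x) i = r *\<^sub>R Poly_Mapping.lookup x i"
proof -
  have "finite {i. r *\<^sub>R Poly_Mapping.lookup x i \<noteq> 0}"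
    by (rule finite_subset[of _ "Poly_Mapping.keys x"]) (auto simp: in_keys_iff)
  then show ?thesis by (simp add: scaleR_poly_mapping_def)
qed

lemma mem_coord_space: "x \<in> coord_space A \<longleftrightarrow> (\<forall>i. i \<notin> A \<longrightarrow> Poly_Mapping.lookup x i = 0)"
  by (auto simp: coord_space_def in_keys_iff)

text \<open>One inequality per vertex set covers all edge subsets, because the induced edges are the
  extreme case for nonnegative weights. The maximum with 0 disappears: for \<open>1 \<le> k\<close>,
  \<open>l \<le> k\<close> and finite nonempty \<open>X\<close> the bound is already
  nonnegative.\<close>

definition sparse_relaxation :: "int \<Rightarrow> int \<Rightarrow> 'v set \<Rightarrow> 'v set set \<Rightarrow> ('v set \<Rightarrow>\<^sub>0 real) set" where
  "sparse_relaxation k l V E = {x \<in> coord_space E.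
     (\<Sum>e\<in>E. Poly_Mapping.lookup x e) = k * int (card V) - l \<and>
     (\<forall>e\<in>E. 0 \<le> Poly_Mapping.lookup x e \<and> Poly_Mapping.lookup x e \<le> 1) \<and>
     (\<forall>X. X \<subseteq> V \<longrightarrow> X \<noteq> {} \<longrightarrow>
       (\<Sum>e\<in>{e\<in>E. e \<subseteq> X}. Poly_Mapping.lookup x e) \<le> k * int (card X) - l)}"

text \<open>Edges inside both sets are those inside \<open>X \<inter> Y\<close>; the difference of
  the two sides is the weight of the edges inside \<open>X \<union> Y\<close> that lie in neither
  set.\<close>

lemma sum_induced_supermodular:
  fixes x :: "'v set \<Rightarrow> real"
  assumes "finite E" "\<And>e. e \<in> E \<Longrightarrow> 0 \<le> x e"
  shows "sum x {e\<in>E. e \<subseteq> X} + sum x {e\<in>E. e \<subseteq> Y}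
    \<le> sum x {e\<in>E. e \<subseteq> X \<union> Y} + sum x {e\<in>E. e \<subseteq> X \<inter> Y}"
proof -
  have "sum x {e\<in>E. e \<subseteq> X} + sum x {e\<in>E. e \<subseteq> Y}
      = sum x ({e\<in>E. e \<subseteq> X} \<union> {e\<in>E. e \<subseteq> Y}) + sum x ({e\<in>E. e \<subseteq> X} \<inter> {e\<in>E. e \<subseteq> Y})"
    using assms(1) by (subst sum.union_inter) auto
  also have "{e\<in>E. e \<subseteq> X} \<inter> {e\<in>E. e \<subseteq> Y} = {e\<in>E. e \<subseteq> X \<inter> Y}" by auto
  also have "sum x ({e\<in>E. e \<subseteq> X} \<union> {e\<in>E. e \<subseteq> Y}) \<le> sum x {e\<in>E. e \<subseteq> X \<union> Y}"
    using assms by (intro sum_mono2) auto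
  finally show ?thesis by simp
qed

text \<open>Uncrossing: the vertex sets at which the sparsity constraint is tight and which meet
  are closed under intersection. In an inclusion-minimal one spanning a fractional edge,
  integrality of its right-hand side forces a second fractional edge, and no tight
  set separates the two.\<close>

lemma fractional_pair:
  fixes x :: "'v set \<Rightarrow> real" and k l :: int
  assumes V: "finite V" "V \<noteq> {}" and E: "\<And>e. e \<in> E \<Longrightarrow> e \<subseteq> V \<and> e \<noteq> {}"
    and x01: "\<And>e. e \<in> E \<Longrightarrow> 0 \<le> x e \<and> x e \<le> 1"
    and total: "sum x E = k * int (card V) - l"
    and le: "\<And>X. X \<subseteq> V \<Longrightarrow> X \<noteq> {} \<Longrightarrow> sum x {e\<in>E. e \<subseteq> X} \<le> k * int (card X) - l"
    and frac: "\<exists>e\<in>E. x e \<noteq> 0 \<and> x e \<noteq> 1"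
  obtains e f where "e \<in> E" "f \<in> E" "e \<noteq> f" "0 < x e" "x e < 1" "0 < x f" "x f < 1"
    "\<And>Y. Y \<subseteq> V \<Longrightarrow> Y \<noteq> {} \<Longrightarrow> sum x {e\<in>E. e \<subseteq> Y} = k * int (card Y) - l \<Longrightarrow> e \<subseteq> Y \<longleftrightarrow> f \<subseteq> Y"
proof -
  define T where "T X \<longleftrightarrow> X \<subseteq> V \<and> X \<noteq> {} \<and> sum x {e\<in>E. e \<subseteq> X} = k * int (card X) - l" for X
  define Fr where "Fr = {e\<in>E. x e \<noteq> 0 \<and> x e \<noteq> 1}"
  have finE: "finite E" using V(1) E by (meson Pow_iff finite_Pow_iff rev_finite_subset subsetI)
  have "{e\<in>E. e \<subseteq> V} = E" using E by auto
  then have TV: "T V" using V total by (simp add: T_def)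
  obtain e0 where e0: "e0 \<in> Fr" using frac by (auto simp: Fr_def)
  define P where "P X \<longleftrightarrow> T X \<and> (\<exists>e\<in>Fr. e \<subseteq> X)" for X
  have "P V" using TV e0 E by (auto simp: P_def Fr_def)
  then obtain X where X: "P X" "\<And>Y. P Y \<Longrightarrow> card X \<le> card Y"
    using arg_min_nat_lemma[of P V card] by blast
  obtain e where e: "e \<in> Fr" "e \<subseteq> X" using X(1) by (auto simp: P_def)
  have TX: "T X" using X(1) by (simp add: P_def)
  then have finX: "finite X" using V(1) finite_subset by (auto simp: T_def)
  have sup: "X \<subseteq> Y" if Y: "T Y" and f: "f \<in> Fr" "f \<subseteq> X" "f \<subseteq> Y" for Y f
  proof -
    have "f \<noteq> {}" using f(1) E by (auto simp: Fr_def)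
    then have ne: "X \<inter> Y \<noteq> {}" using f by auto
    have fY: "finite Y" using Y V(1) finite_subset by (auto simp: T_def)
    have "int (card (X \<union> Y)) + int (card (X \<inter> Y)) = int (card X) + int (card Y)"
      using card_Un_Int[OF finX fY] by linarith
    then have "k * int (card (X \<union> Y)) + k * int (card (X \<inter> Y)) = k * int (card X) + k * int (card Y)"
      by (metis distrib_left)
    then have eq: "real_of_int (k * int (card (X \<union> Y)) - l) + real_of_int (k * int (card (X \<inter> Y)) - l)
        = real_of_int (k * int (card X) - l) + real_of_int (k * int (card Y) - l)"
      by linarith
    have "sum x {e\<in>E. e \<subseteq> X \<union> Y} \<le> k * int (card (X \<union> Y)) - l"
      using TX Y by (intro le) (auto simp: T_def)
    moreover have "sum x {e\<in>E. e \<subseteq> X \<inter> Y} \<le> k * int (card (X \<inter> Y)) - l"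
      using TX ne by (intro le) (auto simp: T_def)
    moreover have "sum x {e\<in>E. e \<subseteq> X} = k * int (card X) - l" "sum x {e\<in>E. e \<subseteq> Y} = k * int (card Y) - l"
      using TX Y by (simp_all add: T_def)
    \<comment> \<open>The right-hand sides are modular in the vertex set and the left-hand sides
      supermodular, so both inequalities must be equalities.\<close>
    ultimately have "sum x {e\<in>E. e \<subseteq> X \<inter> Y} = k * int (card (X \<inter> Y)) - l"
      using eq sum_induced_supermodular[OF finE, of x X Y] x01 by simp
    then have "T (X \<inter> Y)" using TX ne by (auto simp: T_def)
    then have "P (X \<inter> Y)" using f by (auto simp: P_def)
    then have "card X \<le> card (X \<inter> Y)" by (rule X(2))
    then have "X \<inter> Y = X" using finX by (intro card_seteq) auto
    then show ?thesis by blast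
  qed
  have "\<exists>f\<in>Fr. f \<subseteq> X \<and> f \<noteq> e"
  proof (rule ccontr)
    assume no: "\<not> ?thesis"
    have eX: "e \<in> {e\<in>E. e \<subseteq> X}" using e by (auto simp: Fr_def)
    have "sum x ({e\<in>E. e \<subseteq> X} - {e}) \<in> \<int>"
      using no by (intro Ints_sum) (auto simp: Fr_def)
    moreover have "sum x {e\<in>E. e \<subseteq> X} \<in> \<int>" using TX unfolding T_def by simp
    ultimately have "sum x {e\<in>E. e \<subseteq> X} - sum x ({e\<in>E. e \<subseteq> X} - {e}) \<in> \<int>"
      by (intro Ints_diff)
    moreover have "sum x {e\<in>E. e \<subseteq> X} = x e + sum x ({e\<in>E. e \<subseteq> X} - {e})"
      using eX finE by (intro sum.remove) auto
    ultimately have "x e \<in> \<int>" by simp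
    then obtain n where n: "x e = of_int n" by (auto elim: Ints_cases)
    have "0 \<le> x e" "x e \<le> 1" using x01 e(1) by (auto simp: Fr_def)
    then have "n = 0 \<or> n = 1" unfolding n by auto
    then show False using n e(1) by (auto simp: Fr_def)
  qed
  then obtain f where f: "f \<in> Fr" "f \<subseteq> X" "f \<noteq> e" by blast
  have "0 < x g \<and> x g < 1 \<and> g \<in> E" if "g \<in> Fr" for g
    using that x01[of g] by (auto simp: Fr_def less_le)
  note Fr = this
  show thesis
  proof (rule that[of e f])
    fix Y assume Y: "Y \<subseteq> V" "Y \<noteq> {}" "sum x {e\<in>E. e \<subseteq> Y} = k * int (card Y) - l"
    then have "T Y" by (simp add: T_def)
    then have "X \<subseteq> Y" if "e \<subseteq> Y \<or> f \<subseteq> Y" using sup[of Y e] sup[of Y f] e f that by blast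
    then show "e \<subseteq> Y \<longleftrightarrow> f \<subseteq> Y" using e(2) f(2) by blast
  qed (use Fr[OF e(1)] Fr[OF f(1)] f(3) in auto)
qed

text \<open>Such an \<open>x\<close> is the incidence vector of its edges \<open>F\<close> of value
  1, and \<open>F\<close> is tight: for nonempty \<open>F'\<close> the inequality at
  \<open>\<Union>F'\<close> bounds the number of all edges of \<open>F\<close> inside that vertex
  set, \<open>F'\<close> among them.\<close>

lemma integral_mem_tight_polytope:
  fixes V :: "'v set" and k l :: int
  assumes E: "simple_graph V E" and V: "V \<noteq> {}" and kl: "1 \<le> k" "0 \<le> l" "l \<le> k"
    and x: "x \<in> sparse_relaxation k l V E"
    and int: "\<And>e. e \<in> E \<Longrightarrow> Poly_Mapping.lookup x e = 0 \<or> Poly_Mapping.lookup x e = 1"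
  shows "x \<in> tight_polytope k l V E"
proof -
  have finV: "finite V" and EV: "\<And>e. e \<in> E \<Longrightarrow> e \<subseteq> V \<and> card e = 2"
    using E by (auto simp: simple_graph_def)
  then have finE: "finite E" by (meson Pow_iff finite_Pow_iff rev_finite_subset subsetI)
  define F where "F = {e\<in>E. Poly_Mapping.lookup x e = 1}"
  have finF: "finite F" using finE by (simp add: F_def)
  have xF: "Poly_Mapping.lookup x e = (if e \<in> F then 1 else 0)" for e
    using int x by (cases "e \<in> E") (auto simp: F_def sparse_relaxation_def mem_coord_space)
  have sum_x: "sum (Poly_Mapping.lookup x) S = card (S \<inter> F)" if "S \<subseteq> E" for S
    using finite_subset[OF that finE] by (simp add: xF sum.If_cases Int_def)
  have "x = incidence_vec F"
    by (rule poly_mapping_eqI) (simp add: lookup_incidence_vec finF xF)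
  moreover have "tight k l V F"
    unfolding tight_def
  proof
    have "E \<inter> F = F" by (auto simp: F_def)
    then have "real (card F) = k * int (card V) - l"
      using x sum_x[of E] by (simp add: sparse_relaxation_def)
    then have "int (card F) = k * int (card V) - l" by linarith
    then show "int (card F) = max (k * int (card V) - l) 0" by linarith
    show "sparse k l F"
      unfolding sparse_def
    proof (intro allI impI)
      fix F' assume F': "F' \<subseteq> F"
      show "int (card F') \<le> max (k * int (card (\<Union>F')) - l) 0"
      proof (cases "F' = {}")
        case False
        define X where "X = \<Union>F'"
        have F'E: "F' \<subseteq> E" using F' by (auto simp: F_def)
        obtain e where "e \<in> F'" using False by auto
        then have "X \<noteq> {}" using EV F'E by (force simp: X_def)
        moreover have "X \<subseteq> V" using EV F'E by (force simp: X_def)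
        ultimately have "sum (Poly_Mapping.lookup x) {e\<in>E. e \<subseteq> X} \<le> k * int (card X) - l"
          using x by (simp add: sparse_relaxation_def)
        moreover have "F' \<subseteq> {e\<in>E. e \<subseteq> X} \<inter> F" using F' F'E by (auto simp: X_def)
        then have "card F' \<le> card ({e\<in>E. e \<subseteq> X} \<inter> F)" using finF by (intro card_mono) auto
        ultimately have "real (card F') \<le> k * int (card X) - l" using sum_x[of "{e\<in>E. e \<subseteq> X}"] by simp
        then have "int (card F') \<le> k * int (card X) - l" by linarith
        then show ?thesis by (simp add: X_def)
      qed simp
    qed
  qed
  moreover have "F \<subseteq> E" by (auto simp: F_def)
  ultimately show ?thesis
    unfolding tight_polytope_def by (intro hull_inc) auto
qed

text \<open>By \<open>feasible_eq_hull\<close> only vertices matter. At a fractional vertex,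
  shifting weight between the two edges of \<open>fractional_pair\<close> preserves the total and
  every active constraint, against the definition of a vertex.\<close>

lemma sparse_relaxation_subset_tight_polytope:
  fixes V :: "'v set" and k l :: int
  assumes E: "simple_graph V E" and V: "V \<noteq> {}" and kl: "1 \<le> k" "0 \<le> l" "l \<le> k"
  shows "sparse_relaxation k l V E \<subseteq> tight_polytope k l V E"
proof -
  let ?lk = Poly_Mapping.lookup
  have finV: "finite V" and EV: "\<And>e. e \<in> E \<Longrightarrow> e \<subseteq> V \<and> card e = 2"
    using E by (auto simp: simple_graph_def)
  then have finE: "finite E" by (meson Pow_iff finite_Pow_iff rev_finite_subset subsetI)
  define L where "L = {x \<in> coord_space E. (\<Sum>e\<in>E. ?lk x e) = real_of_int (k * int (card V) - l)}"
  \<comment> \<open>Bounds for each edge and a sparsity inequality for each vertex set. Their number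
    is exponential, but only the vertices of this polyhedron are used; its facets are never
    counted.\<close>
  define I where "I = (E \<times> (UNIV :: bool set)) <+> (Pow V - {{}})"
  define g :: "('v set \<times> bool) + 'v set \<Rightarrow> ('v set \<Rightarrow>\<^sub>0 real) \<Rightarrow> real"
    where "g i x = (case i of Inl (e, up) \<Rightarrow> if up then ?lk x e else - ?lk x e
      | Inr X \<Rightarrow> \<Sum>e\<in>{e\<in>E. e \<subseteq> X}. ?lk x e)" for i x
  define b :: "('v set \<times> bool) + 'v set \<Rightarrow> real"
    where "b i = (case i of Inl (e, up) \<Rightarrow> if up then 1 else 0
      | Inr X \<Rightarrow> k * int (card X) - l)" for i
  interpret pointed_polyhedron L I g b
  proof (rule pointed_polyhedron.intro)
    show "affine L"
      unfolding affine_def L_def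
      by (auto simp: mem_coord_space lookup_add sum.distrib simp flip: sum_distrib_left distrib_right)
    show "finite I" using finV finE by (simp add: I_def)
    show "linear (g i)" for i
      by (rule linearI)
        (auto simp: g_def lookup_add sum.distrib sum_distrib_left split: sum.split prod.split)
    fix x d
    assume "x \<in> L" "x + d \<in> L" and le: "\<And>i. i \<in> I \<Longrightarrow> g i d \<le> 0"
    then have "?lk d e = 0" if "e \<notin> E" for e
      using that by (force simp: L_def mem_coord_space lookup_add)
    moreover have "?lk d e = 0" if "e \<in> E" for e
      using le[of "Inl (e, True)"] le[of "Inl (e, False)"] that by (simp add: I_def InlI InrI g_def)
    ultimately show "d = 0" by (intro poly_mapping_eqI) auto
  qed
  have feas: "feasible = sparse_relaxation k l V E"
  proof (intro equalityI subsetI)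
    fix x assume x: "x \<in> feasible"
    then have xL: "x \<in> L" and le: "\<And>i. i \<in> I \<Longrightarrow> g i x \<le> b i"
      by (simp_all add: feasible_def)
    have "0 \<le> ?lk x e \<and> ?lk x e \<le> 1" if "e \<in> E" for e
      using le[of "Inl (e, True)"] le[of "Inl (e, False)"] that by (simp add: I_def InlI InrI g_def b_def)
    moreover have "(\<Sum>e\<in>{e\<in>E. e \<subseteq> X}. ?lk x e) \<le> k * int (card X) - l" if "X \<subseteq> V" "X \<noteq> {}" for X
      using le[of "Inr X"] that by (simp add: I_def InlI InrI g_def b_def)
    ultimately show "x \<in> sparse_relaxation k l V E"
      using xL by (simp add: L_def sparse_relaxation_def)
  next
    fix x assume x: "x \<in> sparse_relaxation k l V E"
    have "g i x \<le> b i" if "i \<in> I" for i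
    proof (cases i)
      case (Inl p)
      then show ?thesis
        using that x by (cases p) (auto simp: I_def g_def b_def sparse_relaxation_def)
    next
      case (Inr X)
      then have "X \<subseteq> V" "X \<noteq> {}" using that by (auto simp: I_def)
      then show ?thesis
        using Inr x by (simp add: g_def b_def sparse_relaxation_def)
    qed
    moreover have "x \<in> L" using x by (simp add: L_def sparse_relaxation_def)
    ultimately show "x \<in> feasible" by (simp add: feasible_def)
  qed
  have "vertices \<subseteq> tight_polytope k l V E"
  proof
    fix x assume x: "x \<in> vertices"
    then have xf: "x \<in> feasible" by (simp add: vertices_def)
    then have xR: "x \<in> sparse_relaxation k l V E" by (simp add: feas)
    have xL: "x \<in> L" using xf by (simp add: feasible_def)
    have "?lk x e = 0 \<or> ?lk x e = 1" if "e \<in> E" for e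
    proof (rule ccontr)
      assume "\<not> ?thesis"
      then have frac: "\<exists>e\<in>E. ?lk x e \<noteq> 0 \<and> ?lk x e \<noteq> 1" using that by auto
      obtain e f where ef: "e \<in> E" "f \<in> E" "e \<noteq> f" "0 < ?lk x e" "?lk x e < 1" "0 < ?lk x f" "?lk x f < 1"
        and sep: "\<And>Y. Y \<subseteq> V \<Longrightarrow> Y \<noteq> {} \<Longrightarrow> sum (?lk x) {e\<in>E. e \<subseteq> Y} = k * int (card Y) - l
          \<Longrightarrow> e \<subseteq> Y \<longleftrightarrow> f \<subseteq> Y"
      proof (rule fractional_pair[OF finV V _ _ _ _ frac])
        show "e \<subseteq> V \<and> e \<noteq> {}" if "e \<in> E" for e using EV[OF that] by auto
        show "0 \<le> ?lk x e \<and> ?lk x e \<le> 1" if "e \<in> E" for e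
          using xR that by (simp add: sparse_relaxation_def)
        show "sum (?lk x) E = k * int (card V) - l"
          using xR by (simp add: sparse_relaxation_def)
        show "sum (?lk x) {e\<in>E. e \<subseteq> X} \<le> k * int (card X) - l" if "X \<subseteq> V" "X \<noteq> {}" for X
          using xR that by (simp add: sparse_relaxation_def)
      qed blast
      define d where "d = Poly_Mapping.single e (1::real) - Poly_Mapping.single f 1"
      have d: "?lk d a = (if a = e then 1 else 0) - (if a = f then 1 else 0)" for a
        by (simp add: d_def lookup_minus lookup_single when_def)
      have sum_d: "sum (?lk d) S = (if e \<in> S then 1 else 0) - (if f \<in> S then 1 else 0)"
        if "S \<subseteq> E" for S
        using finite_subset[OF that finE] by (simp add: d sum_subtractf)
      have "x + d \<in> L"
      proof -
        have "(\<Sum>e\<in>E. ?lk x e + ?lk d e) = (\<Sum>e\<in>E. ?lk x e)"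
          using sum_d[of E] ef by (simp add: sum.distrib)
        then show ?thesis
          using xL ef by (auto simp: L_def mem_coord_space lookup_add d)
      qed
      moreover have "g i d = 0" if i: "i \<in> active x" for i
      proof (cases i)
        \<comment> \<open>An active bound belongs to an edge of value 0 or 1, hence to neither
          \<open>e\<close> nor \<open>f\<close>.\<close>
        case (Inl p)
        then show ?thesis
          using i ef by (cases p) (auto simp: active_def g_def b_def d split: if_splits)
      next
        case (Inr X)
        then have "X \<subseteq> V" "X \<noteq> {}" "sum (?lk x) {e\<in>E. e \<subseteq> X} = k * int (card X) - l"
          using i unfolding active_def by (auto simp: g_def b_def I_def)
        then have "e \<subseteq> X \<longleftrightarrow> f \<subseteq> X" by (rule sep)
        then show ?thesis
          using Inr ef sum_d[of "{e\<in>E. e \<subseteq> X}"] by (simp add: g_def)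
      qed
      ultimately have "d = 0" using x by (auto simp: vertices_def)
      then show False using d[of e] ef by simp
    qed
    then show "x \<in> tight_polytope k l V E"
      using integral_mem_tight_polytope[OF E V kl xR] by blast
  qed
  then have "convex hull vertices \<subseteq> tight_polytope k l V E"
    unfolding tight_polytope_def by (intro hull_minimal convex_convex_hull)
  then show ?thesis using feas feasible_eq_hull by simp
qed

section \<open>The extended formulation\<close>

text \<open>Points of the extension project into \<open>sparse_relaxation\<close>, hence into the
  tight polytope; conversely, each tight edge set is lifted by one orientation per root.\<close>

lemma tight_polytope_extension:
  fixes V :: "'v set" and k l :: int
  assumes E: "simple_graph V E" and V: "V \<noteq> {}" and kl: "1 \<le> k" "0 \<le> l" "l \<le> k"
  shows "\<exists>p Q. extended_formulation E (tight_polytope k l V E) p Q \<and>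
    card (facets Q) \<le> card E + 2 * card V * card E"
proof -
  let ?lk = Poly_Mapping.lookup
  have finV: "finite V" and EV: "\<And>e. e \<in> E \<Longrightarrow> e \<subseteq> V \<and> card e = 2"
    using E by (auto simp: simple_graph_def)
  then have finE: "finite E" by (meson Pow_iff finite_Pow_iff rev_finite_subset subsetI)
  have fine: "finite e" if "e \<in> E" for e using EV[OF that] finV finite_subset by blast
  obtain r0 where r0: "r0 \<in> V" using V by auto
  \<comment> \<open>\<open>J\<close> indexes coordinates and inequalities alike, one inequality per
    coordinate: an upper bound 1 for \<open>Inl e\<close>, a lower bound 0 for
    \<open>Inr (r, e, u)\<close>. So \<open>p\<close> is both the dimension of the ambient space and
    the bound on the number of facets.\<close>
  define J where "J = E <+> Sigma V (\<lambda>_. Sigma E (\<lambda>e. e))"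
  define p where "p = card J"
  have finJ: "finite J" using finV finE fine by (simp add: J_def)
  have card_J: "p = card E + 2 * card V * card E"
  proof -
    have "card (Sigma E (\<lambda>e. e)) = 2 * card E"
      using finE fine EV by (simp add: card_SigmaI)
    then show ?thesis
      using finV finE fine by (simp add: p_def J_def card_Plus card_SigmaI)
  qed
  obtain idx where "bij_betw idx J {0..<card J}" using ex_bij_betw_finite_nat[OF finJ] by auto
  then have idx: "bij_betw idx J {..<p}" by (simp add: p_def lessThan_atLeast0)
  have idx_lt: "idx j < p" if "j \<in> J" for j using bij_betw_apply[OF idx that] by simp
  define vec :: "_ \<Rightarrow> nat \<Rightarrow>\<^sub>0 real"
    where "vec f = Abs_poly_mapping (\<lambda>n. if n < p then f (inv_into J idx n) else 0)" for f
  have "finite {n. (if n < p then f (inv_into J idx n) else (0::real)) \<noteq> 0}" for f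
    by (rule finite_subset[of _ "{..<p}"]) auto
  then have lk_vec: "?lk (vec f) n = (if n < p then f (inv_into J idx n) else 0)" for f n
    by (simp add: vec_def)
  then have vec_idx: "?lk (vec f) (idx j) = f j" if "j \<in> J" for f j
    using that idx_lt idx by (simp add: bij_betw_def inv_into_f_f)
  have vec_coord: "vec f \<in> coord_space {..<p}" for f
    by (simp add: mem_coord_space lk_vec)
  define X where "X q e = ?lk q (idx (Inl e))" for q :: "nat \<Rightarrow>\<^sub>0 real" and e
  define Y where "Y q r e u = ?lk q (idx (Inr (r, e, u)))" for q :: "nat \<Rightarrow>\<^sub>0 real" and r e u
  have X_add: "X (q + q') e = X q e + X q' e" and X_scale: "X (t *\<^sub>R q) e = t * X q e"
    and Y_add: "Y (q + q') r e u = Y q r e u + Y q' r e u"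
    and Y_scale: "Y (t *\<^sub>R q) r e u = t * Y q r e u" for q q' t r e u
    by (simp_all add: X_def Y_def lookup_add)
  define c where "c r u = (if u = r then k - l else k)" for r u :: 'v
  have sum_c: "sum (c r) S = k * int (card S) - l" if "finite S" "r \<in> S" for r S
  proof -
    have "sum (c r) S = (\<Sum>u\<in>S. k - (if u = r then l else 0))"
      by (intro sum.cong) (auto simp: c_def)
    then show ?thesis using that by (simp add: sum_subtractf)
  qed
  define L where "L = {q \<in> coord_space {..<p}.
    (\<forall>r\<in>V. \<forall>e\<in>E. (\<Sum>u\<in>e. Y q r e u) = X q e) \<and>
    (\<forall>r\<in>V. \<forall>u\<in>V. (\<Sum>e\<in>{e\<in>E. u \<in> e}. Y q r e u) = c r u)}"
  define g where "g j q = (case j of Inl e \<Rightarrow> X q e | Inr (r, e, u) \<Rightarrow> - Y q r e u)" for j q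
  define b :: "'v set + 'v \<times> 'v set \<times> 'v \<Rightarrow> real"
    where "b j = (case j of Inl e \<Rightarrow> 1 | Inr _ \<Rightarrow> 0)" for j
  interpret pointed_polyhedron L J g b
  proof (rule pointed_polyhedron.intro)
    show "affine L"
      unfolding affine_def L_def
      by (auto simp: mem_coord_space lookup_add X_add X_scale Y_add Y_scale sum.distrib
          simp flip: sum_distrib_left distrib_right)
    show "finite J" by (rule finJ)
    show "linear (g j)" for j
      by (rule linearI)
        (auto simp: g_def X_add X_scale Y_add Y_scale split: sum.split prod.split)
    fix q d
    assume q: "q \<in> L" "q + d \<in> L" and le: "\<And>j. j \<in> J \<Longrightarrow> g j d \<le> 0"
    have sumY: "(\<Sum>u\<in>e. Y d r e u) = X d e" if "r \<in> V" "e \<in> E" for r e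
      using q that by (simp add: L_def X_add Y_add sum.distrib)
    have Y_ge: "0 \<le> Y d r e u" if "r \<in> V" "e \<in> E" "u \<in> e" for r e u
      using le[of "Inr (r, e, u)"] that by (simp add: J_def InlI InrI g_def)
    \<comment> \<open>In a recession direction \<open>X d e\<close> is at most 0 by its upper bound
      and at least 0 as a sum of orientation values.\<close>
    have X0: "X d e = 0" if "e \<in> E" for e
    proof -
      have "0 \<le> (\<Sum>u\<in>e. Y d r0 e u)" using Y_ge r0 that by (intro sum_nonneg) auto
      moreover have "X d e \<le> 0" using le[of "Inl e"] that by (simp add: J_def InlI InrI g_def)
      ultimately show ?thesis using sumY[OF r0 that] by simp
    qed
    have Y0: "Y d r e u = 0" if "r \<in> V" "e \<in> E" "u \<in> e" for r e u
      using sumY[OF that(1,2)] X0[OF that(2)] Y_ge that fine[OF that(2)]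
      by (simp add: sum_nonneg_eq_0_iff)
    have "?lk d n = 0" for n
    proof (cases "n < p")
      case True
      then obtain j where "j \<in> J" "n = idx j" using idx by (auto simp: bij_betw_def)
      then show ?thesis using X0 Y0 by (auto simp: J_def X_def Y_def)
    next
      case False
      then show ?thesis using q by (auto simp: L_def mem_coord_space lookup_add)
    qed
    then show "d = 0" by (intro poly_mapping_eqI) auto
  qed
  define \<pi> where "\<pi> q = (\<Sum>e\<in>E. Poly_Mapping.single e (X q e))" for q
  have lk_\<pi>: "?lk (\<pi> q) e = (if e \<in> E then X q e else 0)" for q e
    using finE by (simp add: \<pi>_def lookup_sum lookup_single when_def)
  have lin: "linear \<pi>"
    by (rule linearI; rule poly_mapping_eqI) (simp_all add: lk_\<pi> lookup_add X_add X_scale)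
  have surj: "\<pi> ` coord_space {..<p} = coord_space E"
  proof (intro equalityI subsetI)
    fix x assume "x \<in> \<pi> ` coord_space {..<p}"
    then show "x \<in> coord_space E" by (auto simp: mem_coord_space lk_\<pi>)
  next
    fix x :: "'v set \<Rightarrow>\<^sub>0 real" assume x: "x \<in> coord_space E"
    \<comment> \<open>Zero orientation values suffice, as this preimage has to lie in the coordinate
      space only and not in \<open>L\<close>.\<close>
    define q where "q = vec (\<lambda>j. case j of Inl e \<Rightarrow> ?lk x e | Inr _ \<Rightarrow> 0)"
    have "\<pi> q = x"
      using x by (intro poly_mapping_eqI) (simp add: lk_\<pi> X_def q_def vec_idx J_def mem_coord_space InlI)
    moreover have "q \<in> coord_space {..<p}" unfolding q_def by (rule vec_coord)
    ultimately show "x \<in> \<pi> ` coord_space {..<p}" by (metis imageI)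
  qed
  have "\<pi> ` feasible \<subseteq> sparse_relaxation k l V E"
  proof
    fix x assume "x \<in> \<pi> ` feasible"
    then obtain q where q: "q \<in> L" "\<And>j. j \<in> J \<Longrightarrow> g j q \<le> b j" "x = \<pi> q"
      by (auto simp: feasible_def)
    have x: "?lk x e = X q e" if "e \<in> E" for e using that q(3) by (simp add: lk_\<pi>)
    have sumY: "(\<Sum>u\<in>e. Y q r e u) = X q e" if "r \<in> V" "e \<in> E" for r e
      using q(1) that by (simp add: L_def)
    have degY: "(\<Sum>e\<in>{e\<in>E. u \<in> e}. Y q r e u) = c r u" if "r \<in> V" "u \<in> V" for r u
      using q(1) that by (simp add: L_def)
    have Y_ge: "0 \<le> Y q r e u" if "r \<in> V" "e \<in> E" "u \<in> e" for r e u
      using q(2)[of "Inr (r, e, u)"] that by (simp add: J_def InlI InrI g_def b_def)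
    \<comment> \<open>No inequality demands this directly; it is inherited from the orientation for
      \<open>r0\<close>.\<close>
    have X_ge: "0 \<le> X q e" if "e \<in> E" for e
      using sumY[OF r0 that] Y_ge[OF r0 that] by (metis sum_nonneg)
    have X_le: "X q e \<le> 1" if "e \<in> E" for e
      using q(2)[of "Inl e"] that by (simp add: J_def InlI InrI g_def b_def)
    have swap: "(\<Sum>u\<in>S. \<Sum>e\<in>{e\<in>E. u \<in> e}. Y q r e u) = (\<Sum>e\<in>E. \<Sum>u\<in>{u\<in>S. u \<in> e}. Y q r e u)"
      if "finite S" for S r
      using that finE by (rule sum.swap_restrict)
    have "(\<Sum>e\<in>E. ?lk x e) = (\<Sum>e\<in>E. \<Sum>u\<in>{u\<in>V. u \<in> e}. Y q r0 e u)"
    proof (rule sum.cong)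
      fix e assume e: "e \<in> E"
      then have "{u\<in>V. u \<in> e} = e" using EV by auto
      then show "?lk x e = (\<Sum>u\<in>{u\<in>V. u \<in> e}. Y q r0 e u)" using sumY[OF r0 e] x[OF e] by simp
    qed simp
    also have "\<dots> = (\<Sum>u\<in>V. real_of_int (c r0 u))"
      unfolding swap[OF finV, symmetric] using degY[OF r0] by simp
    also have "\<dots> = k * int (card V) - l" using sum_c[OF finV r0] by (simp flip: of_int_sum)
    finally have total: "(\<Sum>e\<in>E. ?lk x e) = k * int (card V) - l" .
    have "(\<Sum>e\<in>{e\<in>E. e \<subseteq> S}. ?lk x e) \<le> k * int (card S) - l" if S: "S \<subseteq> V" "S \<noteq> {}" for S
    proof -
      \<comment> \<open>The root is chosen inside \<open>S\<close>: only then is \<open>l\<close>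
        subtracted from the sum of the in-degrees over \<open>S\<close>.\<close>
      obtain r where r: "r \<in> S" "r \<in> V" using S by auto
      have finS: "finite S" using S finV finite_subset by blast
      have "(\<Sum>e\<in>{e\<in>E. e \<subseteq> S}. ?lk x e) = (\<Sum>e\<in>{e\<in>E. e \<subseteq> S}. \<Sum>u\<in>{u\<in>S. u \<in> e}. Y q r e u)"
      proof (rule sum.cong)
        fix e assume "e \<in> {e\<in>E. e \<subseteq> S}"
        then have e: "e \<in> E" "{u\<in>S. u \<in> e} = e" by auto
        then show "?lk x e = (\<Sum>u\<in>{u\<in>S. u \<in> e}. Y q r e u)" using sumY[OF r(2) e(1)] x[OF e(1)] by simp
      qed simp
      \<comment> \<open>The additional edges have at most one end in \<open>S\<close> and contribute
        nonnegative amounts.\<close>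
      also have "\<dots> \<le> (\<Sum>e\<in>E. \<Sum>u\<in>{u\<in>S. u \<in> e}. Y q r e u)"
        using finE Y_ge[OF r(2)] by (intro sum_mono2 sum_nonneg) auto
      also have "\<dots> = (\<Sum>u\<in>S. real_of_int (c r u))"
        unfolding swap[OF finS, symmetric] using degY[OF r(2)] S by (intro sum.cong) auto
      also have "\<dots> = k * int (card S) - l" using sum_c[OF finS r(1)] by (simp flip: of_int_sum)
      finally show ?thesis .
    qed
    moreover have "x \<in> coord_space E" using q(3) by (simp add: mem_coord_space lk_\<pi>)
    ultimately show "x \<in> sparse_relaxation k l V E"
      using total x X_ge X_le by (simp add: sparse_relaxation_def)
  qed
  then have sub: "\<pi> ` feasible \<subseteq> tight_polytope k l V E"
    using sparse_relaxation_subset_tight_polytope[OF E V kl] by blast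
  have "tight_polytope k l V E \<subseteq> \<pi> ` feasible"
    unfolding tight_polytope_def
  proof (rule hull_minimal)
    show "convex (\<pi> ` feasible)" by (rule convex_linear_image[OF lin convex_feasible])
    show "incidence_vec ` {F. F \<subseteq> E \<and> tight k l V F} \<subseteq> \<pi> ` feasible"
    proof clarify
      fix F assume F: "F \<subseteq> E" "tight k l V F"
      have finF: "finite F" using F(1) finE finite_subset by blast
      have "\<exists>h. (\<forall>e\<in>F. h e \<in> e) \<and> (\<forall>u\<in>V. int (card {e\<in>F. h e = u}) = c r u)" if "r \<in> V" for r
        unfolding c_def using F EV by (intro tight_orientation[OF _ finV kl F(2) that]) auto
      then have "\<exists>h. \<forall>r\<in>V. (\<forall>e\<in>F. h r e \<in> e) \<and> (\<forall>u\<in>V. int (card {e\<in>F. h r e = u}) = c r u)"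
        by (intro bchoice) blast
      then obtain h where h: "\<And>r e. r \<in> V \<Longrightarrow> e \<in> F \<Longrightarrow> h r e \<in> e"
        "\<And>r u. r \<in> V \<Longrightarrow> u \<in> V \<Longrightarrow> int (card {e\<in>F. h r e = u}) = c r u" by blast
      define q where "q = vec (\<lambda>j. case j of Inl e \<Rightarrow> if e \<in> F then 1 else 0
        | Inr (r, e, u) \<Rightarrow> if e \<in> F \<and> h r e = u then 1 else 0)"
      have Xq: "X q e = (if e \<in> F then 1 else 0)" if "e \<in> E" for e
        using that by (simp add: X_def q_def vec_idx J_def InlI)
      have Yq: "Y q r e u = (if e \<in> F \<and> h r e = u then 1 else 0)" if "r \<in> V" "e \<in> E" "u \<in> e" for r e u
        using that by (simp add: Y_def q_def vec_idx J_def InrI)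
      have "(\<Sum>u\<in>e. Y q r e u) = X q e" if "r \<in> V" "e \<in> E" for r e
      proof -
        have "(\<Sum>u\<in>e. Y q r e u) = (\<Sum>u\<in>e. if h r e = u then (if e \<in> F then 1 else 0) else 0)"
          using that by (intro sum.cong) (auto simp: Yq)
        then show ?thesis using that h(1)[OF that(1)] fine by (simp add: Xq)
      qed
      moreover have "(\<Sum>e\<in>{e\<in>E. u \<in> e}. Y q r e u) = c r u" if "r \<in> V" "u \<in> V" for r u
      proof -
        have "(\<Sum>e\<in>{e\<in>E. u \<in> e}. Y q r e u)
            = (\<Sum>e\<in>{e\<in>E. u \<in> e}. if e \<in> {e\<in>F. h r e = u} then 1 else 0)"
          using that by (intro sum.cong) (auto simp: Yq)
        also have "\<dots> = card ({e\<in>E. u \<in> e} \<inter> {e\<in>F. h r e = u})"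
          using finE by (simp add: sum.If_cases Int_def)
        \<comment> \<open>The head of an edge is one of its ends, so edges with head
          \<open>u\<close> automatically contain \<open>u\<close>.\<close>
        also have "{e\<in>E. u \<in> e} \<inter> {e\<in>F. h r e = u} = {e\<in>F. h r e = u}"
          using h(1)[OF that(1)] F(1) by auto
        finally show ?thesis using arg_cong[OF h(2)[OF that], of real_of_int] by simp
      qed
      moreover have "q \<in> coord_space {..<p}" unfolding q_def by (rule vec_coord)
      ultimately have "q \<in> L" by (simp add: L_def)
      moreover have "g j q \<le> b j" if "j \<in> J" for j
      proof (cases j)
        case (Inl e)
        then show ?thesis using that by (auto simp: J_def g_def b_def Xq)
      next
        case (Inr t)
        obtain r e u where "t = (r, e, u)" by (cases t)
        then show ?thesis using Inr that by (auto simp: J_def g_def b_def Yq)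
      qed
      ultimately have "q \<in> feasible" by (simp add: feasible_def)
      moreover have "\<pi> q = incidence_vec F"
        using F(1) by (intro poly_mapping_eqI) (auto simp: lk_\<pi> Xq lookup_incidence_vec[OF finF])
      ultimately show "incidence_vec F \<in> \<pi> ` feasible" by (metis imageI)
    qed
  qed
  then have "\<pi> ` feasible = tight_polytope k l V E" using sub by blast
  moreover have "feasible \<subseteq> coord_space {..<p}" unfolding feasible_def by (auto simp: L_def)
  ultimately have "extended_formulation E (tight_polytope k l V E) p feasible"
    unfolding extended_formulation_def using lin surj polytope_feasible card_J
    by (intro conjI exI[of _ \<pi>]) simp_all
  moreover have "card (facets feasible) \<le> card E + 2 * card V * card E"
    using card_facets_le card_J by (simp add: p_def)
  ultimately show ?thesis by blast
qed

section \<open>The graph without vertices\<close>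

lemma facets_singleton: "facets {a} = {}"
proof -
  have "F = {a}" if "F face_of {a}" "F \<noteq> {}" for F
    using face_of_imp_subset[OF that(1)] that(2) by blast
  then have "F \<notin> facets {a}" for F
    unfolding facets_def by fastforce
  then show ?thesis by blast
qed

text \<open>For \<open>V = {}\<close> the required size is 0, so a formulation without facets is
  called for. The maximum with 0 makes the empty edge set tight, which leaves a single
  point.\<close>

lemma tight_polytope_empty:
  assumes "0 \<le> l"
  shows "tight_polytope k l ({} :: 'v set) {} = {0}"
proof -
  have "tight k l ({} :: 'v set) {}" using assms by (simp add: tight_def sparse_def)
  then have "{F. F \<subseteq> {} \<and> tight k l ({} :: 'v set) F} = {{}}" by blast
  moreover have "incidence_vec {} = (0 :: 'v set \<Rightarrow>\<^sub>0 real)"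
    by (rule poly_mapping_eqI) (simp add: lookup_incidence_vec)
  ultimately show ?thesis
    unfolding tight_polytope_def by (simp only: image_insert image_empty convex_hull_singleton)
qed

lemma extended_formulation_zero: "extended_formulation {} {0} 0 {0}"
proof -
  have "linear (\<lambda>_ :: nat \<Rightarrow>\<^sub>0 real. 0 :: 'a \<Rightarrow>\<^sub>0 real)"
    by (rule linearI) simp_all
  moreover have "polytope {0 :: nat \<Rightarrow>\<^sub>0 real}"
    unfolding polytope_def by (metis convex_hull_singleton finite.emptyI finite.insertI)
  ultimately show ?thesis
    unfolding extended_formulation_def
    by (intro conjI exI[of _ "\<lambda>_. 0"]) (simp_all add: coord_space_def)
qed

theorem theorem1:
  shows "\<exists>C::real. \<forall>(k::int) (l::int) (V::'v set) (E::'v set set).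
    1 \<le> k \<longrightarrow> 0 \<le> l \<longrightarrow> l \<le> k \<longrightarrow> simple_graph V E \<longrightarrow>
    (\<exists>(p::nat) Q. extended_formulation E (tight_polytope k l V E) p Q \<and>
       real (card (facets Q)) \<le> C * real (card V) * real (card E))"
\<comment> \<open>For nonempty \<open>V\<close>, \<open>card E \<le> card V * card E\<close>; added
  to \<open>2 * card V * card E\<close> this gives the constant 3.\<close>
proof (rule exI[of _ 3], intro allI impI)
  fix k l :: int and V :: "'v set" and E :: "'v set set"
  assume kl: "1 \<le> k" "0 \<le> l" "l \<le> k" and E: "simple_graph V E"
  show "\<exists>(p::nat) Q. extended_formulation E (tight_polytope k l V E) p Q \<and>
       real (card (facets Q)) \<le> 3 * real (card V) * real (card E)"
  proof (cases "V = {}")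
    case True
    then have "E = {}" using E by (auto simp: simple_graph_def)
    then show ?thesis
      using True kl(2)
      by (intro exI[of _ 0] exI[of _ "{0}"])
        (simp add: tight_polytope_empty extended_formulation_zero facets_singleton)
  next
    case False
    then obtain p Q where Q: "extended_formulation E (tight_polytope k l V E) p Q"
      "card (facets Q) \<le> card E + 2 * card V * card E"
      using tight_polytope_extension[OF E _ kl] by blast
    have "1 * card E \<le> card V * card E"
      using False E by (intro mult_right_mono) (auto simp: simple_graph_def Suc_le_eq card_gt_0_iff)
    then have "card (facets Q) \<le> 3 * card V * card E" using Q(2) by linarith
    then have "real (card (facets Q)) \<le> real (3 * card V * card E)" by (rule of_nat_mono)
    then show ?thesis using Q(1) by auto
  qed
qed

end
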